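(* Assume that $Y$ is a (real) topological vector space, (i) $D\subset Y$ is a set for which there exists some nonempty proper closed subset $H$ of $Y$ with $\operatorname{core}0^+H\neq\emptyset$ and $H-(D\setminus\{0\})\subseteq\operatorname{core}H$, (ii) $F\subseteq Y$ is a nonempty compact set, or ($D+D\subseteq D$ and there exists some $y\in Y$ such that $F\cap(y-D)$ is a nonempty compact set). Then $\operatorname{Eff}(F,D)\neq\emptyset$. Each set $D$ for which $D\setminus\{0\}$ is contained in the core of a non-trivial closed convex cone $C$ fulfills assumption (i).
   Context: $\operatorname{Eff}(F,D):=\{y^0\in F\mid F\cap(y^0-D)\subseteq\{y^0\}\}$ is the set of efficient elements of $F$ with respect to $D$. For a subset $A$ of $Y$, $\operatorname{core}A$ denotes the algebraic interior of $A$, and $0^+A:=\{u\in Y\mid \forall a\in A\ \forall t\in\mathbb{R}_+: a+tu\in A\}$ denotes the recession cone of $A$, where $\mathbb{R}_+=\{x\in\mathbb{R}\mid x\ge 0\}$. A set $C\subseteq Y$ is a cone if $\mathbb{R}_+C\subseteq C$; it is non-trivial if $C\neq\emptyset$, $C\neq\{0\}$ and $C\neq Y$.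
   Formalization: In the last sentence the core of the cone C is assumed nonempty; this matters only if D is contained in {0}, where the literal claim fails (Y = L^p[0,1] with 0<p<1, D = {0}, C a closed ray). *)

theory Defs
  imports "HOL-Analysis.Analysis"
begin

text \<open>Real topological vector spaces. The topology is not required to be Hausdorff.\<close>

class real_topological_vector = real_vector + topological_ab_group_add +
  assumes tendsto_scaleR_nhds:
    "((\<lambda>p. fst p *\<^sub>R snd p) \<longlongrightarrow> r *\<^sub>R x) (nhds r \<times>\<^sub>F nhds x)"

instance real_normed_vector \<subseteq> real_topological_vector
  by standard (intro tendsto_scaleR filterlim_fst filterlim_snd)

definition algebraic_core :: "'a::real_vector set \<Rightarrow> 'a set" where
  "algebraic_core A = {a \<in> A. \<forall>v. \<exists>t>0. \<forall>s\<in>{0..t}. a + s *\<^sub>R v \<in> A}"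

definition recession_cone :: "'a::real_vector set \<Rightarrow> 'a set" where
  "recession_cone A = {u. \<forall>a\<in>A. \<forall>t\<ge>0. a + t *\<^sub>R u \<in> A}"

definition Eff :: "'a::real_vector set \<Rightarrow> 'a set \<Rightarrow> 'a set" where
  "Eff F D = {y0 \<in> F. F \<inter> {y0 - d | d. d \<in> D} \<subseteq> {y0}}"

definition nontrivial_cone :: "'a::real_vector set \<Rightarrow> bool" where
  "nontrivial_cone C \<longleftrightarrow> cone C \<and> C \<noteq> {} \<and> C \<noteq> {0} \<and> C \<noteq> UNIV"

definition separating_domination_set :: "'a::real_topological_vector set \<Rightarrow> bool" where
  "separating_domination_set D \<longleftrightarrow>
    (\<exists>H. H \<noteq> {} \<and> H \<noteq> UNIV \<and> closed H \<and> algebraic_core (recession_cone H) \<noteq> {} \<and>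
         {h - d | h d. h \<in> H \<and> d \<in> D - {0}} \<subseteq> algebraic_core H)"

end

theory Submission
  imports Defs
begin

text \<open>
  Existence of efficient elements follows from a scalarization. Let \<open>H\<close> be a closed proper nonempty set and
  \<open>u\<close> a core point of its recession cone. Along every line in direction \<open>u\<close> the set \<open>H\<close> cuts out
  exactly a closed half-line \<open>[\<phi> y, \<infinity>)\<close>: moving in direction \<open>u\<close> stays in \<open>H\<close> because \<open>u\<close> is a
  recession direction; every line enters \<open>H\<close> because a large multiple of \<open>u\<close> outweighs any fixed
  displacement; and no line lies in \<open>H\<close>, since otherwise \<open>H\<close> would, by the same absorption, be the
  whole space. The parameter \<open>\<phi> y\<close> of the entrance point, called
  \<open>entrance u H y\<close> below, is finite and satisfies \<open>\<phi> y \<le> t \<longleftrightarrow> y + t *\<^sub>R u \<in> H\<close>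
  (\<open>entrance_le_iff\<close>). Its sublevel sets
  are translates of \<open>H\<close>, so it is lower semicontinuous, and its strict sublevel set
  \<open>{y. \<phi> y < 0}\<close> contains the core of \<open>H\<close> (\<open>entrance_less_if_core\<close>). Hence \<open>H - (D - {0}) \<subseteq> core H\<close> says that subtracting a
  nonzero element of \<open>D\<close> strictly decreases \<open>\<phi>\<close>.

  A lower semicontinuous function attains its minimum on a nonempty compact set
  (\<open>compact_attains_min_of_closed_sublevels\<close>), and a minimizer of a strictly monotone function is
  efficient. If only a section \<open>F \<inter> (y - D)\<close> is compact, then its efficient
  elements are also efficient in \<open>F\<close>, because \<open>D + D \<subseteq> D\<close> makes everything that dominates a point of the
  section belong to the section.

  For a cone \<open>C\<close> one takes \<open>H = - C\<close>; what has to be seen is \<open>C + core C \<subseteq> core C\<close> and that \<open>- C\<close> is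
  contained in its own recession cone.
\<close>

section \<open>The entrance functional of a closed set\<close>

lemma continuous_on_line:
  fixes y u :: "'a::real_topological_vector"
  shows "continuous_on UNIV (\<lambda>t. y + t *\<^sub>R u)"
proof -
  have "((\<lambda>t. t *\<^sub>R u) \<longlongrightarrow> r *\<^sub>R u) (nhds r)" for r
  proof -
    have "filterlim (\<lambda>t. (t, u)) (nhds r \<times>\<^sub>F nhds u) (nhds r)"
      by (intro filterlim_Pair filterlim_ident tendsto_const)
    from filterlim_compose[OF tendsto_scaleR_nhds this] show ?thesis
      by simp
  qed
  then have "continuous_on UNIV (\<lambda>t. t *\<^sub>R u)"
    by (simp add: continuous_on_def tendsto_mono[OF at_within_le_nhds])
  then show ?thesis
    by (intro continuous_on_add continuous_on_const)
qed

text \<open>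
  For large \<open>s\<close> the displacement \<open>s *\<^sub>R u + w = s *\<^sub>R (u + (1 / s) *\<^sub>R w)\<close> is a multiple of a point near
  \<open>u\<close>, hence of a recession direction. The bound on \<open>s\<close> does not depend on the point of \<open>H\<close>.
\<close>

lemma recession_core_absorbs:
  assumes "u \<in> algebraic_core (recession_cone H)"
  obtains t where "t > 0" "\<And>s h. s \<ge> t \<Longrightarrow> h \<in> H \<Longrightarrow> h + (s *\<^sub>R u + w) \<in> H"
proof -
  obtain e where e: "e > 0" "\<And>r. r \<in> {0..e} \<Longrightarrow> u + r *\<^sub>R w \<in> recession_cone H"
    using assms unfolding algebraic_core_def by blast
  have "h + (s *\<^sub>R u + w) \<in> H" if "s \<ge> 1 / e" "h \<in> H" for s h
  proof -
    have "1 / e > 0"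
      using e(1) by simp
    then have s: "s > 0"
      using that(1) by linarith
    then have "1 / s \<in> {0..e}"
      using that(1) e(1) by (simp add: field_simps)
    then have "h + s *\<^sub>R (u + (1 / s) *\<^sub>R w) \<in> H"
      using e(2) that(2) s by (simp add: recession_cone_def)
    then show ?thesis
      using s by (simp add: scaleR_add_right)
  qed
  with e(1) show thesis
    by (intro that[of "1 / e"]) auto
qed

text \<open>
  This is Gerstewitz's (Tammer's) nonlinear scalarization functional for the set \<open>H\<close> and the
  direction \<open>- u\<close>.
\<close>

definition entrance :: "'a::real_vector \<Rightarrow> 'a set \<Rightarrow> 'a \<Rightarrow> real" where
  "entrance u H y = Inf {t. y + t *\<^sub>R u \<in> H}"

text \<open>
  Three properties of the parameter set make the infimum a finite minimum: it is nonempty and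
  bounded below by absorption, and closed because \<open>H\<close> is. Every use of the functional goes through
  this equivalence.
\<close>

lemma entrance_le_iff:
  fixes H :: "'a::real_topological_vector set"
  assumes H: "H \<noteq> {}" "H \<noteq> UNIV" "closed H"
    and u: "u \<in> algebraic_core (recession_cone H)"
  shows "entrance u H y \<le> t \<longleftrightarrow> y + t *\<^sub>R u \<in> H"
proof -
  let ?T = "{t. y + t *\<^sub>R u \<in> H}"
  have up: "t \<in> ?T" if "s \<in> ?T" "s \<le> t" for s t
  proof -
    have "u \<in> recession_cone H"
      using u by (simp add: algebraic_core_def)
    then have "(y + s *\<^sub>R u) + (t - s) *\<^sub>R u \<in> H"
      using that by (simp add: recession_cone_def)
    then show ?thesis
      by (simp add: algebra_simps)
  qed
  have ne: "?T \<noteq> {}"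
  proof -
    obtain h where h: "h \<in> H"
      using H(1) by blast
    obtain t where "t > 0" "\<And>s g. s \<ge> t \<Longrightarrow> g \<in> H \<Longrightarrow> g + (s *\<^sub>R u + (y - h)) \<in> H"
      using recession_core_absorbs[OF u, of "y - h"] by blast
    from this(2)[of t h] h have "t \<in> ?T"
      by (simp add: algebra_simps)
    then show ?thesis
      by blast
  qed
  have bdd: "bdd_below ?T"
  proof -
    obtain z where z: "z \<notin> H"
      using H(2) by blast
    obtain t where t: "t > 0" "\<And>s g. s \<ge> t \<Longrightarrow> g \<in> H \<Longrightarrow> g + (s *\<^sub>R u + (z - y)) \<in> H"
      using recession_core_absorbs[OF u, of "z - y"] by blast
    have "- t \<le> r" if "r \<in> ?T" for r
    proof (rule ccontr)
      \<comment> \<open>From a point of \<open>H\<close> so far back on the line, a displacement that \<open>H\<close> absorbs leads to \<open>z\<close>.\<close>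
      assume "\<not> - t \<le> r"
      then have "(y + r *\<^sub>R u) + ((- r) *\<^sub>R u + (z - y)) \<in> H"
        using t(2)[of "- r" "y + r *\<^sub>R u"] that by simp
      with z show False
        by simp
    qed
    then show ?thesis
      by (rule bdd_belowI)
  qed
  have "closed ?T"
    using closed_vimage[OF H(3) continuous_on_line[of y u]] by (simp add: vimage_def)
  then have "Inf ?T \<in> ?T"
    by (rule closed_contains_Inf[OF ne bdd])
  then show ?thesis
    unfolding entrance_def using up[of "Inf ?T" t] cInf_lower[OF _ bdd, of t] by blast
qed

text \<open>
  A core point of \<open>H\<close> can still be moved a little backwards along \<open>u\<close> without leaving \<open>H\<close>.
\<close>

lemma entrance_less_if_core:
  fixes H :: "'a::real_topological_vector set"
  assumes H: "H \<noteq> {}" "H \<noteq> UNIV" "closed H"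
    and u: "u \<in> algebraic_core (recession_cone H)"
    and core: "y + t *\<^sub>R u \<in> algebraic_core H"
  shows "entrance u H y < t"
proof -
  obtain e where e: "e > 0" "\<And>s. s \<in> {0..e} \<Longrightarrow> (y + t *\<^sub>R u) + s *\<^sub>R (- u) \<in> H"
    using core unfolding algebraic_core_def by blast
  from e(1) e(2)[of e] have "y + (t - e) *\<^sub>R u \<in> H"
    by (simp add: algebra_simps)
  then have "entrance u H y \<le> t - e"
    by (simp add: entrance_le_iff[OF H u])
  with e(1) show ?thesis
    by linarith
qed

section \<open>Existence of efficient elements\<close>

text \<open>
  If no value on \<open>S\<close> were smallest, the open sets \<open>{x. f a < f x}\<close> with \<open>a \<in> S\<close> would cover \<open>S\<close>; but the
  point with the smallest value among the finitely many \<open>a\<close> of a subcover is not covered.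
\<close>

lemma compact_attains_min_of_closed_sublevels:
  fixes f :: "'a::topological_space \<Rightarrow> 'b::linorder"
  assumes S: "compact S" "S \<noteq> {}"
    and closed: "\<And>t. closed {x. f x \<le> t}"
  shows "\<exists>x\<in>S. \<forall>z\<in>S. f x \<le> f z"
proof (rule ccontr)
  assume "\<not> ?thesis"
  then have no_min: "\<exists>z\<in>S. f z < f x" if "x \<in> S" for x
    using that by (meson not_le)
  have "- {x. f x \<le> f a} = {x. f a < f x}" for a
    by (auto simp: not_le)
  then have op: "open {x. f a < f x}" for a
    using closed[of "f a"] by (metis open_Compl)
  have "S \<subseteq> (\<Union>a\<in>S. {x. f a < f x})"
    using no_min by blast
  then obtain A where A: "A \<subseteq> S" "finite A" "S \<subseteq> (\<Union>a\<in>A. {x. f a < f x})"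
    by (rule compactE_image[OF S(1) op])
  from A(3) S(2) have "A \<noteq> {}"
    by blast
  then have "Min (f ` A) \<in> f ` A"
    using A(2) by (intro Min_in) auto
  then obtain a where a: "a \<in> A" "f a = Min (f ` A)"
    by auto
  then obtain b where "b \<in> A" "f b < f a"
    using A(1,3) by blast
  with a(2) A(2) show False
    by (simp add: not_le[symmetric])
qed

lemma efficient_in_compact:
  fixes D F :: "'a::real_topological_vector set"
  assumes D: "separating_domination_set D" and F: "compact F" "F \<noteq> {}"
  shows "Eff F D \<noteq> {}"
proof -
  from D obtain H where H: "H \<noteq> {}" "H \<noteq> UNIV" "closed H"
    and core: "algebraic_core (recession_cone H) \<noteq> {}"
    and HD: "{h - d | h d. h \<in> H \<and> d \<in> D - {0}} \<subseteq> algebraic_core H"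
    unfolding separating_domination_set_def by (elim exE conjE)
  from core obtain u where u: "u \<in> algebraic_core (recession_cone H)"
    by (meson ex_in_conv)
  note le_iff = entrance_le_iff[OF H u]
  have decreasing: "entrance u H (y - d) < entrance u H y" if "d \<in> D" "d \<noteq> 0" for y d
  proof -
    have "y + entrance u H y *\<^sub>R u \<in> H"
      using le_iff by blast
    with that have "(y + entrance u H y *\<^sub>R u) - d \<in> {h - d | h d. h \<in> H \<and> d \<in> D - {0}}"
      by blast
    with HD have "(y + entrance u H y *\<^sub>R u) - d \<in> algebraic_core H"
      by (rule subsetD)
    then show ?thesis
      by (intro entrance_less_if_core[OF H u]) (simp add: algebra_simps)
  qed
  have "closed {y. entrance u H y \<le> t}" for t
  proof -
    have "continuous_on UNIV (\<lambda>y. y + t *\<^sub>R u)"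
      by (intro continuous_on_add continuous_on_id continuous_on_const)
    from closed_vimage[OF H(3) this] show ?thesis
      by (simp add: le_iff vimage_def)
  qed
  then obtain y0 where y0: "y0 \<in> F" "\<And>z. z \<in> F \<Longrightarrow> entrance u H y0 \<le> entrance u H z"
    using compact_attains_min_of_closed_sublevels[OF F] by blast
  have "F \<inter> {y0 - d | d. d \<in> D} \<subseteq> {y0}"
  proof clarify
    fix d
    assume d: "y0 - d \<in> F" "d \<in> D"
    then have "\<not> entrance u H (y0 - d) < entrance u H y0"
      using y0(2) by (simp add: not_less)
    with d(2) decreasing have "d = 0"
      by blast
    then show "y0 - d = y0"
      by simp
  qed
  with y0(1) show ?thesis
    unfolding Eff_def by blast
qed

lemma Eff_section_subset_Eff:
  assumes "{d + e | d e. d \<in> D \<and> e \<in> D} \<subseteq> D"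
  shows "Eff (F \<inter> {y - d | d. d \<in> D}) D \<subseteq> Eff F D"
proof
  fix y0
  assume y0: "y0 \<in> Eff (F \<inter> {y - d | d. d \<in> D}) D"
  then obtain d0 where d0: "y0 = y - d0" "d0 \<in> D"
    by (auto simp: Eff_def)
  have "y0 - d \<in> {y - d | d. d \<in> D}" if "d \<in> D" for d
  proof -
    have "d0 + d \<in> D"
      using assms d0(2) that by blast
    moreover have "y0 - d = y - (d0 + d)"
      using d0(1) by simp
    ultimately show ?thesis
      by blast
  qed
  with y0 show "y0 \<in> Eff F D"
    unfolding Eff_def by blast
qed

section \<open>Domination sets inside the core of a cone\<close>

lemma algebraic_core_mono:
  assumes "A \<subseteq> B"
  shows "algebraic_core A \<subseteq> algebraic_core B"
  using assms unfolding algebraic_core_def by blast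

lemma algebraic_core_uminus:
  assumes "a \<in> algebraic_core A"
  shows "- a \<in> algebraic_core (uminus ` A)"
proof -
  have "\<exists>t>0. \<forall>s\<in>{0..t}. - a + s *\<^sub>R v \<in> uminus ` A" for v
  proof -
    obtain t where "t > 0" "\<forall>s\<in>{0..t}. a + s *\<^sub>R (- v) \<in> A"
      using assms unfolding algebraic_core_def by blast
    moreover have "- a + s *\<^sub>R v = - (a + s *\<^sub>R (- v))" for s
      by simp
    ultimately show ?thesis
      by blast
  qed
  with assms show ?thesis
    unfolding algebraic_core_def by blast
qed

text \<open>
  A translation that maps \<open>A\<close> into itself carries the segments around \<open>a\<close> to segments in \<open>A\<close>. For a
  convex cone this covers every translation by one of its elements.
\<close>

lemma algebraic_core_translate_closed:
  assumes add: "\<And>a. a \<in> A \<Longrightarrow> c + a \<in> A" and a: "a \<in> algebraic_core A"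
  shows "c + a \<in> algebraic_core A"
proof -
  have "\<exists>t>0. \<forall>s\<in>{0..t}. (c + a) + s *\<^sub>R v \<in> A" for v
  proof -
    obtain t where "t > 0" "\<forall>s\<in>{0..t}. a + s *\<^sub>R v \<in> A"
      using a unfolding algebraic_core_def by blast
    then show ?thesis
      using add by (auto simp: add.assoc)
  qed
  with a add show ?thesis
    by (simp add: algebraic_core_def)
qed

lemma separating_domination_set_if_core_cone:
  fixes C D :: "'a::real_topological_vector set"
  assumes C: "nontrivial_cone C" "closed C" "convex C" "algebraic_core C \<noteq> {}"
    and D: "D - {0} \<subseteq> algebraic_core C"
  shows "separating_domination_set D"
proof -
  let ?H = "uminus ` C"
  have "convex C \<and> cone C"
    using C(1,3) by (simp add: nontrivial_cone_def)
  then have add: "x + y \<in> C" if "x \<in> C" "y \<in> C" for x y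
    using that by (simp add: convex_cone)
  have scale: "t *\<^sub>R x \<in> C" if "x \<in> C" "t \<ge> 0" for x t
    using C(1) that by (simp add: nontrivial_cone_def cone_def)
  have H_eq: "?H = uminus -` C"
    by force
  have "?H \<noteq> {}"
    using C(1) by (simp add: nontrivial_cone_def)
  moreover have "?H \<noteq> UNIV"
    using C(1) unfolding H_eq nontrivial_cone_def
    by (metis UNIV_I UNIV_eq_I minus_minus vimage_eq)
  moreover have "closed ?H"
    unfolding H_eq by (intro closed_vimage C(2) continuous_on_minus continuous_on_id)
  moreover have "algebraic_core (recession_cone ?H) \<noteq> {}"
  proof -
    have "- (x + t *\<^sub>R v) \<in> C" if "- x \<in> C" "- v \<in> C" "t \<ge> 0" for x v t
      using add[OF that(1) scale[OF that(2,3)]] by simp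
    then have "?H \<subseteq> recession_cone ?H"
      by (auto simp: recession_cone_def H_eq)
    then have "algebraic_core ?H \<subseteq> algebraic_core (recession_cone ?H)"
      by (rule algebraic_core_mono)
    moreover have "algebraic_core ?H \<noteq> {}"
      using C(4) algebraic_core_uminus[of _ C] by blast
    ultimately show ?thesis
      by blast
  qed
  moreover have "{h - d | h d. h \<in> ?H \<and> d \<in> D - {0}} \<subseteq> algebraic_core ?H"
  proof clarsimp
    fix c d
    assume "c \<in> C" "d \<in> D" "d \<noteq> 0"
    then have "c + d \<in> algebraic_core C"
      using D add by (intro algebraic_core_translate_closed) auto
    from algebraic_core_uminus[OF this] show "- c - d \<in> algebraic_core ?H"
      by simp
  qed
  ultimately show ?thesis
    unfolding separating_domination_set_def by - (intro exI[of _ ?H] conjI)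
qed

theorem theorem4:
  shows "(\<forall>(D :: 'a::real_topological_vector set) F.
            separating_domination_set D \<longrightarrow>
            (F \<noteq> {} \<and> compact F) \<or>
            ({d + e | d e. d \<in> D \<and> e \<in> D} \<subseteq> D \<and>
             (\<exists>y. F \<inter> {y - d | d. d \<in> D} \<noteq> {} \<and> compact (F \<inter> {y - d | d. d \<in> D}))) \<longrightarrow>
            Eff F D \<noteq> {}) \<and>
         (\<forall>(D :: 'a set) C.
            nontrivial_cone C \<longrightarrow> closed C \<longrightarrow> convex C \<longrightarrow> algebraic_core C \<noteq> {} \<longrightarrow>
            D - {0} \<subseteq> algebraic_core C \<longrightarrow>
            separating_domination_set D)"
proof (intro conjI allI impI)
  fix D F :: "'a set"
  assume D: "separating_domination_set D"
    and "F \<noteq> {} \<and> compact F \<or>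
      ({d + e | d e. d \<in> D \<and> e \<in> D} \<subseteq> D \<and>
       (\<exists>y. F \<inter> {y - d | d. d \<in> D} \<noteq> {} \<and> compact (F \<inter> {y - d | d. d \<in> D})))"
  then consider "F \<noteq> {}" "compact F"
    | y where "{d + e | d e. d \<in> D \<and> e \<in> D} \<subseteq> D"
        "F \<inter> {y - d | d. d \<in> D} \<noteq> {}" "compact (F \<inter> {y - d | d. d \<in> D})"
    by blast
  then show "Eff F D \<noteq> {}"
  proof cases
    case 1
    then show ?thesis
      using efficient_in_compact[OF D] by blast
  next
    case 2
    then show ?thesis
      using efficient_in_compact[OF D 2(3,2)] Eff_section_subset_Eff[OF 2(1)] by blast
  qed
next
  fix D C :: "'a set"
  assume "nontrivial_cone C" "closed C" "convex C" "algebraic_core C \<noteq> {}"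
    "D - {0} \<subseteq> algebraic_core C"
  then show "separating_domination_set D"
    by (rule separating_domination_set_if_core_cone)
qed

end
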